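(* Let $2\le m\le N$ and let $q=(q_{ij})\in\mathbb{C}^{N^2}$. Assume that there are no constants in $\mathcal{B}_{(s)}$ for any proper subset $s\subset\{1,\dots,m\}$. Then the dimension of the space of constants in $\mathcal{B}_{1\ldots m}=\mathcal{B}_{(\{1,\dots,m\})}$ is $(m-2)!$ if $\sigma_{1\ldots m}=1$, and is $0$ otherwise.
   Context: Let $\mathcal{B}$ be the unital associative $\mathbb{C}$-algebra freely generated by $\xi_1,\dots,\xi_N$. Given parameters $q=(q_{ij})_{i,j=1}^N\in\mathbb{C}^{N^2}$, let $\partial_1,\dots,\partial_N:\mathcal{B}\to\mathcal{B}$ be the linear operators determined by $\partial_i 1=0$ and $\partial_i(\xi_jx)=\delta_{ij}x+q_{ij}\xi_j\partial_ix$ for all $x\in\mathcal{B}$. A constant is a nonzero element $C$ of $\mathcal{B}$ with zero component in polynomial degree $0$ such that $\partial_iC=0$ for $i=1,\dots,N$; the space of constants in a subspace means the linear space formed by the constants in it together with $0$. For a nonempty subset $s=\{i_1,\dots,i_{|s|}\}$ of $\{1,\dots,N\}$, $\mathcal{B}_{(s)}$ is the space of polynomials homogeneous of degree $|s|$ that are separately linear in $\xi_{i_1},\dots,\xi_{i_{|s|}}$, i.e. the linear span of the $|s|!$ monomials $\xi_{j_1}\cdots\xi_{j_{|s|}}$ with $(j_1,\dots,j_{|s|})$ a permutation of the elements of $s$. Further, $\sigma_{(s)}=\prod_{i\ne j\in s}q_{ij}$ (product over all ordered pairs of distinct elements of $s$), and $\sigma_{1\ldots m}=\sigma_{(\{1,\dots,m\})}$.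 *)

theory Defs
  imports Complex_Main "HOL-Library.Poly_Mapping" "HOL-Combinatorics.Multiset_Permutations"
begin

section \<open>The free algebra\<close>

text \<open>
  Words form the free monoid, written additively so that the convolution product of
  finitely supported functions makes \<^typ>\<open>'a \<Rightarrow>\<^sub>0 complex\<close> the free
  unital associative algebra when \<^typ>\<open>'a\<close> is a type of words.
\<close>

datatype 'a fword = FWord (letters: "'a list")

instantiation fword :: (type) monoid_add
begin

definition zero_fword :: "'a fword" where
  "zero_fword = FWord []"

definition plus_fword :: "'a fword \<Rightarrow> 'a fword \<Rightarrow> 'a fword" where
  "plus_fword u v = FWord (letters u @ letters v)"

instance
  by standard (simp_all add: zero_fword_def plus_fword_def)

end

type_synonym falg = "nat fword \<Rightarrow>\<^sub>0 complex"

definition scale :: "complex \<Rightarrow> falg \<Rightarrow> falg" where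
  "scale c x = Poly_Mapping.map ((*) c) x"

lemma lookup_scale [simp]: "Poly_Mapping.lookup (scale c x) w = c * Poly_Mapping.lookup x w"
  by (simp add: scale_def Poly_Mapping.map.rep_eq when_def)

global_interpretation falg: vector_space scale
  by standard (rule poly_mapping_eqI; simp add: lookup_add algebra_simps)+

lemma falg_induct [case_names single sum]:
  fixes x :: falg
  assumes single: "\<And>w c. P (Poly_Mapping.single w c)"
    and sum: "\<And>x y. P x \<Longrightarrow> P y \<Longrightarrow> P (x + y)"
  shows "P x"
proof (induction x rule: Poly_Mapping.update_induct)
  case const
  show ?case using single[of undefined 0] by simp
next
  case (update x w c)
  have "Poly_Mapping.update w c x = x + Poly_Mapping.single w c"
    using update by (intro poly_mapping_eqI) (auto simp: lookup_update lookup_add lookup_single when_def in_keys_iff)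
  then show ?case using sum[OF update(3) single] by simp
qed

definition xi :: "nat \<Rightarrow> falg" where
  "xi i = Poly_Mapping.single (FWord [i]) 1"

text \<open>The generators are indexed by all natural numbers; the algebra on
  \<open>\<xi>\<^sub>1, \<dots>, \<xi>\<^sub>N\<close> is the following subalgebra.\<close>

definition free_algebra :: "nat \<Rightarrow> falg set" where
  "free_algebra N = {x. \<forall>w \<in> Poly_Mapping.keys x. set (letters w) \<subseteq> {1..N}}"


section \<open>The twisted derivations\<close>

text \<open>The defining recursion on monomials, followed by linear extension. That this yields the
  operators determined by the recursion on all of the algebra is shown below.\<close>

primrec pd_word :: "(nat \<Rightarrow> nat \<Rightarrow> complex) \<Rightarrow> nat \<Rightarrow> nat list \<Rightarrow> falg" where
  "pd_word q i [] = 0"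
| "pd_word q i (j # js) =
     (if i = j then Poly_Mapping.single (FWord js) 1 else 0) + scale (q i j) (xi j * pd_word q i js)"

definition pd :: "(nat \<Rightarrow> nat \<Rightarrow> complex) \<Rightarrow> nat \<Rightarrow> falg \<Rightarrow> falg" where
  "pd q i x = (\<Sum>w \<in> Poly_Mapping.keys x. scale (Poly_Mapping.lookup x w) (pd_word q i (letters w)))"

lemma pd_superset:
  assumes "finite A" "Poly_Mapping.keys x \<subseteq> A"
  shows "pd q i x = (\<Sum>w \<in> A. scale (Poly_Mapping.lookup x w) (pd_word q i (letters w)))"
  unfolding pd_def using assms
  by (intro sum.mono_neutral_left) (auto simp: in_keys_iff)

lemma pd_add: "pd q i (x + y) = pd q i x + pd q i y"
proof -
  let ?A = "Poly_Mapping.keys x \<union> Poly_Mapping.keys y"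
  have "Poly_Mapping.keys (x + y) \<subseteq> ?A" by (rule Poly_Mapping.keys_add)
  then show ?thesis
    by (simp add: pd_superset[where A = ?A] lookup_add falg.scale_left_distrib sum.distrib)
qed

lemma pd_scale: "pd q i (scale c x) = scale c (pd q i x)"
proof -
  have "Poly_Mapping.keys (scale c x) \<subseteq> Poly_Mapping.keys x" by (auto simp: in_keys_iff)
  then show ?thesis
    by (simp add: pd_superset[where A = "Poly_Mapping.keys x"] falg.scale_sum_right)
qed

lemma pd_single: "pd q i (Poly_Mapping.single w c) = scale c (pd_word q i (letters w))"
  by (simp add: pd_def)

lemma scale_mult_right: "x * scale c y = scale c (x * y)"
proof (induction y rule: falg_induct)
  case (single w d)
  show ?case
  proof (induction x rule: falg_induct)
    case (single v e)
    have "scale c (Poly_Mapping.single w d) = Poly_Mapping.single w (c * d)" for w d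
      by (rule poly_mapping_eqI) (simp add: lookup_single when_def)
    then show ?case by (simp add: mult_single mult.left_commute)
  next
    case (sum x y)
    then show ?case by (simp add: distrib_right falg.scale_right_distrib)
  qed
next
  case (sum x y)
  then show ?case by (simp add: distrib_left falg.scale_right_distrib)
qed

lemma pd_one: "pd q i 1 = 0"
  by (simp add: single_one[symmetric] pd_single zero_fword_def del: single_one)

lemma pd_xi_mult: "pd q i (xi j * x) = (if i = j then x else 0) + scale (q i j) (xi j * pd q i x)"
proof (induction x rule: falg_induct)
  case (single w c)
  have "scale c (Poly_Mapping.single w 1) = Poly_Mapping.single w c"
    by (rule poly_mapping_eqI) (simp add: lookup_single when_def)
  then show ?case
    by (cases w) (simp add: xi_def mult_single pd_single plus_fword_def scale_mult_right
        falg.scale_right_distrib mult.commute)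
next
  case (sum x y)
  then show ?case
    by (simp add: distrib_left pd_add falg.scale_right_distrib)
qed

lemma pd_unique:
  assumes add: "\<And>x y. D (x + y) = D x + D y"
    and scale: "\<And>c x. D (scale c x) = scale c (D x)"
    and one: "D 1 = 0"
    and xi: "\<And>j x. D (xi j * x) = (if i = j then x else 0) + scale (q i j) (xi j * D x)"
  shows "D = pd q i"
proof
  fix x
  have word: "D (Poly_Mapping.single (FWord js) 1) = pd_word q i js" for js
  proof (induction js)
    case Nil
    show ?case using one by (simp add: zero_fword_def[symmetric])
  next
    case (Cons j js)
    have "Poly_Mapping.single (FWord (j # js)) 1 = xi j * Poly_Mapping.single (FWord js) 1"
      by (simp add: xi_def mult_single plus_fword_def)
    then show ?case using Cons by (simp add: xi)
  qed
  show "D x = pd q i x"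
  proof (induction x rule: falg_induct)
    case (single w c)
    have "Poly_Mapping.single w c = scale c (Poly_Mapping.single w 1)"
      by (rule poly_mapping_eqI) (simp add: lookup_single when_def)
    then show ?case
      using word[of "letters w"] by (simp add: scale pd_scale pd_single)
  next
    case (sum x y)
    then show ?case by (simp add: add pd_add)
  qed
qed


lemma pd_closed:
  assumes "x \<in> free_algebra N"
  shows "pd q i x \<in> free_algebra N"
proof -
  have add: "x + y \<in> free_algebra N" if "x \<in> free_algebra N" "y \<in> free_algebra N" for x y
    using that Poly_Mapping.keys_add[of x y] by (auto simp: free_algebra_def)
  have scale: "scale c x \<in> free_algebra N" if "x \<in> free_algebra N" for c x
    using that by (auto simp: free_algebra_def in_keys_iff)
  have zero: "0 \<in> free_algebra N" by (simp add: free_algebra_def)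
  have xi: "xi j * x \<in> free_algebra N" if "j \<in> {1..N}" "x \<in> free_algebra N" for j x
    using that Poly_Mapping.keys_mult[of "xi j" x]
    by (force simp: free_algebra_def xi_def plus_fword_def)
  have word: "pd_word q i js \<in> free_algebra N" if "set js \<subseteq> {1..N}" for js
    using that
  proof (induction js)
    case Nil
    show ?case by (simp add: zero)
  next
    case (Cons j js)
    have "Poly_Mapping.single (FWord js) 1 \<in> free_algebra N"
      using Cons.prems by (simp add: free_algebra_def)
    then show ?case
      using Cons by (simp add: add scale xi zero)
  qed
  have sum: "sum f A \<in> free_algebra N" if "\<And>w. w \<in> A \<Longrightarrow> f w \<in> free_algebra N"
    for f :: "nat fword \<Rightarrow> falg" and A
    using that by (induction A rule: infinite_finite_induct) (auto intro: add zero)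
  show ?thesis
    unfolding pd_def using assms by (intro sum scale word) (auto simp: free_algebra_def)
qed


section \<open>Constants\<close>

definition is_constant :: "nat \<Rightarrow> (nat \<Rightarrow> nat \<Rightarrow> complex) \<Rightarrow> falg \<Rightarrow> bool" where
  "is_constant N q C \<longleftrightarrow>
     C \<in> free_algebra N \<and> C \<noteq> 0 \<and> Poly_Mapping.lookup C (FWord []) = 0 \<and> (\<forall>i \<in> {1..N}. pd q i C = 0)"

definition multilinear :: "nat set \<Rightarrow> falg set" where
  "multilinear s = falg.span {prod_list (map xi js) | js. js \<in> permutations_of_set s}"

text \<open>\<^term>\<open>multilinear s\<close> is finite-dimensional for finite \<open>s\<close>, so \<^term>\<open>falg.dim\<close>, which is \<open>0\<close>
  for spaces without a finite basis, is the true dimension on its subspaces.\<close>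

definition constants_in :: "nat \<Rightarrow> (nat \<Rightarrow> nat \<Rightarrow> complex) \<Rightarrow> falg set \<Rightarrow> falg set" where
  "constants_in N q V = {C \<in> V. is_constant N q C} \<union> {0}"

lemma subspace_constants_in:
  assumes "falg.subspace V"
  shows "falg.subspace (constants_in N q V)"
proof -
  have pd0: "pd q i 0 = 0" for i by (simp add: pd_def)
  have eq: "constants_in N q V = {C \<in> V. C \<in> free_algebra N \<and>
      Poly_Mapping.lookup C (FWord []) = 0 \<and> (\<forall>i \<in> {1..N}. pd q i C = 0)}"
    using falg.subspace_0[OF assms]
    by (auto simp: constants_in_def is_constant_def free_algebra_def pd0)
  have add: "x + y \<in> free_algebra N" if "x \<in> free_algebra N" "y \<in> free_algebra N" for x y
    using that Poly_Mapping.keys_add[of x y] by (auto simp: free_algebra_def)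
  have scale: "scale c x \<in> free_algebra N" if "x \<in> free_algebra N" for c x
    using that by (auto simp: free_algebra_def in_keys_iff)
  have zero: "0 \<in> free_algebra N" by (simp add: free_algebra_def)
  show ?thesis
    unfolding eq using assms
    by (auto simp: falg.subspace_def pd0 pd_add pd_scale lookup_add add scale zero)
qed

definition sigma :: "(nat \<Rightarrow> nat \<Rightarrow> complex) \<Rightarrow> nat set \<Rightarrow> complex" where
  "sigma q s = (\<Prod>(i, j) \<in> {(i, j). i \<in> s \<and> j \<in> s \<and> i \<noteq> j}. q i j)"

end

theory Submission
  imports Defs
begin

text \<open>
  Why the theorem holds.  Identify an element of \<open>\<B>\<^sub>(\<^sub>s\<^sub>)\<close> with the function \<open>f\<close> of its coefficients
  on the permutation words of \<open>s\<close>.  Let \<open>T\<close> be the operator \<open>x \<mapsto> \<Sum>\<^sub>a \<xi>\<^sub>a \<partial>\<^sub>a x\<close>, whose kernel consists of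
  the constants: it moves each letter in turn to the front, with a weight.  Let \<open>R\<close> be the summand
  that moves the last letter to the front, and let \<open>S = T - R\<close>, which fixes the last letter and is
  the operator \<open>T\<close> of the remaining letters.  Moving a letter \<open>b\<close> to the front and then another
  letter \<open>a\<close> in front of it gives the same word as moving \<open>a\<close> first and then \<open>b\<close> to the second
  place, up to the factor \<open>q\<^sub>a\<^sub>b q\<^sub>b\<^sub>a\<close>.  This yields the factorisation
  \<open>T (1 - R) = (1 - D) S\<close>, known from the determinant formula for quon algebras, where \<open>D\<close> is
  a weighted rotation of all letters but the first (\<open>twisted_deriv_minus_rot\<close>).  If \<open>n = |s|\<close>, then
  \<open>R\<^sup>n\<close> and \<open>D\<^sup>n\<^sup>-\<^sup>1\<close> are both multiplication by \<open>\<sigma>\<^sub>(\<^sub>s\<^sub>)\<close>.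

  The absence of constants in the spaces with one letter fewer says that \<open>S\<close> is injective.  If
  \<open>\<sigma>\<^sub>(\<^sub>s\<^sub>) \<noteq> 1\<close>, then \<open>1 - R\<close> is bijective and \<open>1 - D\<close> injective, so that \<open>T\<close> is injective
  (\<open>const_free_if_sigma_neq_1\<close>).

  Let \<open>\<sigma>\<^sub>(\<^sub>s\<^sub>) = 1\<close> and fix \<open>c \<noteq> d\<close> in \<open>s\<close>.  The key point is that every constant has the form
  \<open>f = z - R z\<close> (\<open>potential_of_annihilated\<close>).  Indeed, modulo the image of \<open>1 - R\<close> it is some
  \<open>\<xi>\<^sub>c y\<close>, and then \<open>T (\<xi>\<^sub>c y)\<close> lies in the image of \<open>1 - D\<close>; as each \<open>D\<close>-orbit contains only one
  word with \<open>c\<close> in second place, this forces \<open>\<partial>\<^sub>k y = 0\<close> for all \<open>k\<close>, and \<open>y = 0\<close> because there are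
  no constants in \<open>\<B>\<^sub>(\<^sub>s\<^sub>-\<^sub>c\<^sub>)\<close>.  Normalise \<open>z\<close> to vanish on the words with last letter \<open>c\<close>; this makes
  it unique.  Then \<open>w = S z\<close> is \<open>D\<close>-invariant and vanishes on the words with last letter \<open>c\<close>, hence on
  all words whose first letter differs from \<open>c\<close>.  On the words with first letter \<open>c\<close> it is an
  invariant function for the rotation of the other \<open>n - 1\<close> letters, so it is freely determined by
  its values on the \<open>(n - 2)!\<close> words with first letter \<open>c\<close> and last letter \<open>d\<close>.  These values are
  coordinates on the space of constants: they separate constants since \<open>S\<close> is injective
  (\<open>annihilated_eq_0_if_coords_eq_0\<close>), and they can be prescribed since an injective endomorphism
  of a finite-dimensional space is surjective (\<open>annihilated_dual_basis\<close>).
\<close>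

section \<open>Permutation words and twisted rotations\<close>

abbreviation perms :: "'a set \<Rightarrow> 'a list set" where
  "perms \<equiv> permutations_of_set"

lemma perms_iff: "v \<in> perms s \<longleftrightarrow> distinct v \<and> set v = s"
  by (auto simp: permutations_of_set_def)

lemma perms_Cons: "a # u \<in> perms s \<longleftrightarrow> a \<in> s \<and> u \<in> perms (s - {a})"
  by (auto simp: perms_iff)

lemma perms_snoc: "u @ [a] \<in> perms s \<longleftrightarrow> a \<in> s \<and> u \<in> perms (s - {a})"
  by (auto simp: perms_iff)

lemma perms_rotate: "rotate n v \<in> perms s \<longleftrightarrow> v \<in> perms s"
  by (simp add: perms_iff)

lemma perms_rotate1: "rotate1 v \<in> perms s \<longleftrightarrow> v \<in> perms s"
  by (simp add: perms_iff)

lemma perms_insertion: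
  assumes "mset v = add_mset a (mset u)"
  shows "v \<in> perms s \<longleftrightarrow> a \<in> s \<and> u \<in> perms (s - {a})"
proof -
  have "mset v = mset (a # u)" using assms by simp
  then have "distinct v \<longleftrightarrow> distinct (a # u)" "set v = set (a # u)"
    by (rule mset_eq_imp_distinct_iff, metis assms mset.simps(2) set_mset_mset)
  then show ?thesis unfolding perms_Cons[symmetric] by (simp add: perms_iff)
qed

lemma prod_list_perms:
  assumes "v \<in> perms t"
  shows "prod_list (map g v) = prod g t"
  using assms prod.distinct_set_conv_list[of v g] by (simp add: perms_iff)

lemma perms_Diff_commute: "perms (s - {a} - {b}) = perms (s - {b} - {a})"
  by (rule arg_cong[where f = perms]) blast

text \<open>Operators act on coefficient functions, so \<open>rot \<chi>\<close> describes the map that moves the last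
  letter \<open>a\<close> of a word to the front, with weight \<open>\<chi> a\<close>.\<close>

definition rot :: "('a \<Rightarrow> complex) \<Rightarrow> ('a list \<Rightarrow> complex) \<Rightarrow> 'a list \<Rightarrow> complex" where
  "rot \<chi> f v = \<chi> (hd v) * f (rotate1 v)"

lemma rot_Cons [simp]: "rot \<chi> f (a # u) = \<chi> a * f (u @ [a])"
  by (simp add: rot_def)

text \<open>The \<open>j\<close>-fold iterate of \<^const>\<open>rot\<close>, for \<open>j\<close> up to the length of the word.\<close>

definition rot_pow :: "('a \<Rightarrow> complex) \<Rightarrow> ('a list \<Rightarrow> complex) \<Rightarrow> nat \<Rightarrow> 'a list \<Rightarrow> complex" where
  "rot_pow \<chi> f j v = prod_list (map \<chi> (take j v)) * f (rotate j v)"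

lemma rot_pow_0 [simp]: "rot_pow \<chi> f 0 v = f v"
  by (simp add: rot_pow_def)

lemma rot_pow_rot:
  assumes "j < length v"
  shows "rot_pow \<chi> (rot \<chi> f) j v = rot_pow \<chi> f (Suc j) v"
proof -
  have "hd (rotate j v) = v ! j"
    using assms by (subst hd_rotate_conv_nth) auto
  then show ?thesis
    using assms by (simp add: rot_pow_def rot_def take_Suc_conv_app_nth)
qed

lemma rot_rot_pow:
  assumes "j < length v"
  shows "\<chi> (hd v) * rot_pow \<chi> f j (rotate1 v) = rot_pow \<chi> f (Suc j) v"
  using assms by (cases v) (simp_all add: rot_pow_def rotate1_rotate_swap)

lemma rot_pow_length:
  assumes "v \<in> perms t"
  shows "rot_pow \<chi> f (length v) v = prod \<chi> t * f v"
  using assms by (simp add: rot_pow_def prod_list_perms)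

definition orbit_sum :: "('a \<Rightarrow> complex) \<Rightarrow> ('a list \<Rightarrow> complex) \<Rightarrow> 'a list \<Rightarrow> complex" where
  "orbit_sum \<chi> f v = (\<Sum>j<length v. rot_pow \<chi> f j v)"

text \<open>After a full turn a word returns to itself with the total weight \<open>prod \<chi> t\<close>, so both orders
  of composing \<^const>\<open>orbit_sum\<close> with \<open>1 - rot\<close> telescope to the scalar \<open>1 - prod \<chi> t\<close>.\<close>

lemma orbit_sum_minus_rot:
  assumes "v \<in> perms t"
  shows "orbit_sum \<chi> f v - rot \<chi> (orbit_sum \<chi> f) v = (1 - prod \<chi> t) * f v"
proof -
  have "rot \<chi> (orbit_sum \<chi> f) v = (\<Sum>j<length v. rot_pow \<chi> f (Suc j) v)"
    by (simp add: rot_def orbit_sum_def sum_distrib_left rot_rot_pow)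
  then have "orbit_sum \<chi> f v - rot \<chi> (orbit_sum \<chi> f) v
      = (\<Sum>j<length v. rot_pow \<chi> f j v - rot_pow \<chi> f (Suc j) v)"
    by (simp add: orbit_sum_def sum_subtractf)
  also have "\<dots> = f v - rot_pow \<chi> f (length v) v"
    by (subst sum_lessThan_telescope') simp
  finally show ?thesis
    using assms by (simp add: rot_pow_length algebra_simps)
qed

lemma orbit_sum_of_minus_rot:
  assumes h: "\<And>w. w \<in> perms t \<Longrightarrow> h w = g w - rot \<chi> g w" and v: "v \<in> perms t"
  shows "orbit_sum \<chi> h v = (1 - prod \<chi> t) * g v"
proof -
  have "rot_pow \<chi> h j v = rot_pow \<chi> g j v - rot_pow \<chi> g (Suc j) v" if "j < length v" for j
  proof -
    have "h (rotate j v) = g (rotate j v) - rot \<chi> g (rotate j v)"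
      using h v by (simp add: perms_rotate)
    then have "rot_pow \<chi> h j v = rot_pow \<chi> g j v - rot_pow \<chi> (rot \<chi> g) j v"
      by (simp add: rot_pow_def right_diff_distrib)
    then show ?thesis using that by (simp add: rot_pow_rot)
  qed
  then have "orbit_sum \<chi> h v = (\<Sum>j<length v. rot_pow \<chi> g j v - rot_pow \<chi> g (Suc j) v)"
    by (simp add: orbit_sum_def)
  also have "\<dots> = g v - rot_pow \<chi> g (length v) v"
    by (subst sum_lessThan_telescope') simp
  finally show ?thesis
    using v by (simp add: rot_pow_length algebra_simps)
qed

text \<open>The letters of \<open>v\<close> are distinct, so no other rotation of \<open>v\<close> has the same first or the same
  last letter.\<close>

lemma orbit_sum_eq_self:
  assumes v: "v \<in> perms t" "v \<noteq> []"
    and 0: "(\<forall>w\<in>perms t. hd w \<noteq> hd v \<longrightarrow> h w = 0) \<or>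
            (\<forall>w\<in>perms t. last w \<noteq> last v \<longrightarrow> h w = 0)"
  shows "orbit_sum \<chi> h v = h v"
proof -
  have "rot_pow \<chi> h j v = 0" if j: "0 < j" "j < length v" for j
  proof -
    have d: "distinct v" using v by (simp add: perms_iff)
    have "hd (rotate j v) = v ! j"
      using j by (subst hd_rotate_conv_nth) auto
    moreover have "hd v = v ! 0" using v by (simp add: hd_conv_nth)
    ultimately have 1: "hd (rotate j v) \<noteq> hd v"
      using d j v by (simp add: nth_eq_iff_index_eq)
    have "last (rotate j v) = last (take j v)"
      using j by (cases "take j v = []") (auto simp: rotate_drop_take)
    also have "\<dots> = v ! (j - 1)"
      using j by (subst last_conv_nth) auto
    finally have "last (rotate j v) = v ! (j - 1)" .
    moreover have "last v = v ! (length v - 1)"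
      using v by (simp add: last_conv_nth)
    ultimately have 2: "last (rotate j v) \<noteq> last v"
      using d j v by (simp add: nth_eq_iff_index_eq)
    have "rotate j v \<in> perms t" using v by (simp add: perms_rotate)
    then show ?thesis using 0 1 2 by (auto simp: rot_pow_def)
  qed
  then have "orbit_sum \<chi> h v = (\<Sum>j\<in>{0}. rot_pow \<chi> h j v)"
    unfolding orbit_sum_def using v by (intro sum.mono_neutral_right) auto
  then show ?thesis by simp
qed

text \<open>Every rotation orbit contains a word with last letter \<open>b\<close>, and invariance propagates the
  zero found there.\<close>

lemma rot_invariant_eq_0:
  assumes inv: "\<And>w. w \<in> perms t \<Longrightarrow> g w = rot \<chi> g w"
    and 0: "\<And>u. u @ [b] \<in> perms t \<Longrightarrow> g (u @ [b]) = 0"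
    and "b \<in> t" "v \<in> perms t"
  shows "g v = 0"
proof -
  have "g (u @ b # w) = 0" if "u @ b # w \<in> perms t" for u w
    using that
  proof (induction u arbitrary: w)
    case Nil
    then have "w @ [b] \<in> perms t" by (auto simp: perms_iff)
    then show ?case using inv[of "b # w"] 0[of w] Nil by simp
  next
    case (Cons a u)
    then have "u @ b # w @ [a] \<in> perms t" by (auto simp: perms_iff)
    then have "g (u @ b # w @ [a]) = 0" using Cons.IH[of "w @ [a]"] by simp
    then show ?case using inv[of "a # u @ b # w"] Cons.prems by simp
  qed
  moreover obtain u w where "v = u @ b # w"
    using assms(3,4) by (metis perms_iff split_list)
  ultimately show ?thesis using assms(4) by simp
qed

text \<open>Solving \<open>z - rot \<chi> z = f\<close> along a rotation orbit, starting from the word with first letter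
  \<open>c\<close>, where \<open>z\<close> is given the value of \<open>f\<close>, leads to this sum over the rotations up to the one that
  brings \<open>c\<close> to the front.  Only the equation at the word with first letter \<open>c\<close>, where the orbit
  closes up, can then fail.\<close>

definition potential :: "'a \<Rightarrow> ('a \<Rightarrow> complex) \<Rightarrow> ('a list \<Rightarrow> complex) \<Rightarrow> 'a list \<Rightarrow> complex" where
  "potential c \<chi> f v = (\<Sum>j\<le>length (takeWhile (\<lambda>a. a \<noteq> c) v). rot_pow \<chi> f j v)"

lemma potential_Cons_same: "potential c \<chi> f (c # u) = f (c # u)"
  by (simp add: potential_def)

lemma potential_Cons_other:
  assumes "a \<noteq> c" "c \<in> set u"
  shows "potential c \<chi> f (a # u) = f (a # u) + \<chi> a * potential c \<chi> f (u @ [a])"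
proof -
  let ?k = "length (takeWhile (\<lambda>a. a \<noteq> c) u)"
  have k: "?k \<le> length u" by (rule length_takeWhile_le)
  have tw: "takeWhile (\<lambda>a. a \<noteq> c) (u @ [a]) = takeWhile (\<lambda>a. a \<noteq> c) u"
    using assms by (subst takeWhile_append1) auto
  have "potential c \<chi> f (a # u) = f (a # u) + (\<Sum>j\<le>?k. rot_pow \<chi> f (Suc j) (a # u))"
    using assms by (simp add: potential_def sum.atMost_Suc_shift del: sum.atMost_Suc)
  also have "(\<Sum>j\<le>?k. rot_pow \<chi> f (Suc j) (a # u)) = (\<Sum>j\<le>?k. \<chi> a * rot_pow \<chi> f j (u @ [a]))"
    using k rot_rot_pow[of _ "a # u" \<chi> f] by (intro sum.cong) auto
  finally show ?thesis by (simp add: potential_def tw sum_distrib_left)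
qed


section \<open>The derivations on coefficients\<close>

text \<open>The coefficient of \<open>u\<close> in \<open>\<partial>\<^sub>a x\<close> is a weighted sum of the coefficients of \<open>x\<close> at the words
  obtained by inserting \<open>a\<close> into \<open>u\<close>: each letter \<open>b\<close> to the left of the inserted \<open>a\<close> contributes
  a factor \<open>q a b\<close>.\<close>

primrec twisted_deriv ::
    "('a \<Rightarrow> 'a \<Rightarrow> complex) \<Rightarrow> 'a \<Rightarrow> ('a list \<Rightarrow> complex) \<Rightarrow> 'a list \<Rightarrow> complex" where
  "twisted_deriv q a f [] = f [a]"
| "twisted_deriv q a f (b # u) = f (a # b # u) + q a b * twisted_deriv q a (\<lambda>w. f (b # w)) u"

lemma twisted_deriv_cong:
  assumes "\<And>v. mset v = add_mset a (mset u) \<Longrightarrow> f v = g v"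
  shows "twisted_deriv q a f u = twisted_deriv q a g u"
  using assms
proof (induction u arbitrary: f g)
  case (Cons b u)
  have "twisted_deriv q a (\<lambda>w. f (b # w)) u = twisted_deriv q a (\<lambda>w. g (b # w)) u"
    by (rule Cons.IH) (simp add: Cons.prems)
  then show ?case using Cons.prems by simp
qed simp

lemma twisted_deriv_cong_perms:
  assumes "\<And>v. v \<in> perms s \<Longrightarrow> f v = g v" "a \<in> s" "u \<in> perms (s - {a})"
  shows "twisted_deriv q a f u = twisted_deriv q a g u"
proof (rule twisted_deriv_cong)
  fix v assume "mset v = add_mset a (mset u)"
  then have "v \<in> perms s" using assms(2,3) by (simp add: perms_insertion)
  then show "f v = g v" by (rule assms(1))
qed

lemma twisted_deriv_zero [simp]: "twisted_deriv q a (\<lambda>_. 0) u = 0"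
  by (induction u) simp_all

lemma twisted_deriv_add:
  "twisted_deriv q a (\<lambda>w. f w + g w) u = twisted_deriv q a f u + twisted_deriv q a g u"
  by (induction u arbitrary: f g) (simp_all add: algebra_simps)

lemma twisted_deriv_cmult:
  "twisted_deriv q a (\<lambda>w. k * f w) u = k * twisted_deriv q a f u"
  by (induction u arbitrary: f) (simp_all add: algebra_simps)

lemma twisted_deriv_diff:
  "twisted_deriv q a (\<lambda>w. f w - g w) u = twisted_deriv q a f u - twisted_deriv q a g u"
  using twisted_deriv_add[of q a f "\<lambda>w. - 1 * g w" u] twisted_deriv_cmult[of q a "- 1" g u] by simp

lemma twisted_deriv_snoc:
  "twisted_deriv q a f (u @ [b]) =
     twisted_deriv q a (\<lambda>w. f (w @ [b])) u + prod_list (map (q a) (u @ [b])) * f (u @ [b, a])"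
  by (induction u arbitrary: f) (simp_all add: algebra_simps)

text \<open>These are the insertions of \<open>a\<close> other than the one at the end.  In the notation of the
  introduction, \<open>inner_deriv q a f v\<close> is the value of \<open>S f\<close> at the word \<open>a # v\<close>.\<close>

definition inner_deriv ::
    "('a \<Rightarrow> 'a \<Rightarrow> complex) \<Rightarrow> 'a \<Rightarrow> ('a list \<Rightarrow> complex) \<Rightarrow> 'a list \<Rightarrow> complex" where
  "inner_deriv q a f v = twisted_deriv q a (\<lambda>w. f (w @ [last v])) (butlast v)"

lemma inner_deriv_snoc [simp]:
  "inner_deriv q a f (u @ [b]) = twisted_deriv q a (\<lambda>w. f (w @ [b])) u"
  by (simp add: inner_deriv_def)

text \<open>This is the weight that \<open>a\<close> collects when it moves past all other letters of a permutation
  word of \<open>s\<close>.\<close>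

definition row :: "('a \<Rightarrow> 'a \<Rightarrow> complex) \<Rightarrow> 'a set \<Rightarrow> 'a \<Rightarrow> complex" where
  "row q s a = (\<Prod>b\<in>s - {a}. q a b)"

lemma sigma_eq_prod_row:
  assumes "finite s"
  shows "sigma q s = prod (row q s) s"
proof -
  have "{(i, j). i \<in> s \<and> j \<in> s \<and> i \<noteq> j} = (SIGMA i:s. s - {i})" by auto
  then show ?thesis
    using prod.Sigma[of s "\<lambda>i. s - {i}" q] assms by (simp add: sigma_def row_def)
qed

text \<open>The weights of \<open>D\<close> on the words with first letter \<open>a\<close> have the same total product as the
  weights of \<open>R\<close>, so that both rotations have the eigenvalue \<open>1\<close> under the same condition.\<close>

lemma prod_inner_weights:
  assumes "finite s" "a \<in> s"
  shows "(\<Prod>b\<in>s - {a}. q a b * row q s b) = prod (row q s) s"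
proof -
  have "(\<Prod>b\<in>s - {a}. q a b * row q s b) = row q s a * prod (row q s) (s - {a})"
    by (simp add: prod.distrib row_def)
  then show ?thesis using assms by (simp add: prod.remove[of s a])
qed

text \<open>The factorisation \<open>T (1 - R) = (1 - D) S\<close>, read off at the word \<open>a # v\<close>.  Inserting \<open>a\<close> at the
  end of \<open>v\<close> in \<open>f\<close>, and inserting it in front of \<open>v\<close> in \<open>rot (row q s) f\<close>, both give
  \<open>row q s a * f (v @ [a])\<close>, and these terms cancel.  The other insertions of \<open>a\<close> into \<open>b # u\<close> in the
  rotated function leave \<open>b\<close> in front; they are the inner insertions into \<open>u @ [b]\<close>, with the
  extra factor \<open>q a b\<close> from \<open>b\<close> standing to the left of \<open>a\<close> and \<open>row q s b\<close> from the rotation.\<close>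

lemma twisted_deriv_minus_rot:
  assumes "a \<in> s" "v \<in> perms (s - {a})" "v \<noteq> []"
  shows "twisted_deriv q a (\<lambda>w. f w - rot (row q s) f w) v =
    inner_deriv q a f v - rot (\<lambda>b. q a b * row q s b) (inner_deriv q a f) v"
proof -
  obtain b u where bu: "v = b # u" using assms(3) by (cases v) auto
  obtain u' c where uc: "v = u' @ [c]" using assms(3) by (cases v rule: rev_cases) auto
  have "prod_list (map (q a) v) = row q s a"
    using assms(2) by (simp add: row_def prod_list_perms)
  then have "twisted_deriv q a f v = inner_deriv q a f v + row q s a * f (v @ [a])"
    by (simp add: uc twisted_deriv_snoc)
  moreover have "twisted_deriv q a (rot (row q s) f) v =
      row q s a * f (v @ [a]) + rot (\<lambda>b. q a b * row q s b) (inner_deriv q a f) v"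
    by (simp add: bu twisted_deriv_cmult)
  ultimately show ?thesis by (simp add: twisted_deriv_diff)
qed


section \<open>Annihilated coefficient functions\<close>

text \<open>The derivations only involve the values of \<open>f\<close> on the permutation words of \<open>s\<close>, which makes it
  possible to state everything for arbitrary functions on words.\<close>

definition annihilated :: "('a \<Rightarrow> 'a \<Rightarrow> complex) \<Rightarrow> 'a set \<Rightarrow> ('a list \<Rightarrow> complex) \<Rightarrow> bool" where
  "annihilated q s f \<longleftrightarrow> (\<forall>a\<in>s. \<forall>v\<in>perms (s - {a}). twisted_deriv q a f v = 0)"

definition const_free :: "('a \<Rightarrow> 'a \<Rightarrow> complex) \<Rightarrow> 'a set \<Rightarrow> bool" where
  "const_free q s \<longleftrightarrow> (\<forall>f. annihilated q s f \<longrightarrow> (\<forall>v\<in>perms s. f v = 0))"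

lemma const_freeD:
  assumes "const_free q s" "\<And>a v. a \<in> s \<Longrightarrow> v \<in> perms (s - {a}) \<Longrightarrow> twisted_deriv q a f v = 0"
    "v \<in> perms s"
  shows "f v = 0"
proof -
  have "annihilated q s f" using assms(2) by (simp add: annihilated_def)
  then show ?thesis using assms(1,3) by (simp add: const_free_def)
qed

lemma nonempty_if_perms:
  assumes "v \<in> perms (s - {a})" "c \<in> s" "d \<in> s" "c \<noteq> d"
  shows "v \<noteq> []"
proof
  assume "v = []"
  then have "s \<subseteq> {a}" using assms(1) by (simp add: perms_iff)
  then show False using assms(2-4) by blast
qed

lemma inner_deriv_rot_invariant:
  assumes "annihilated q s f" "c \<in> s" "d \<in> s" "c \<noteq> d"
    and f: "\<And>v. v \<in> perms s \<Longrightarrow> f v = z v - rot (row q s) z v"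
    and a: "a \<in> s" "v \<in> perms (s - {a})"
  shows "inner_deriv q a z v = rot (\<lambda>b. q a b * row q s b) (inner_deriv q a z) v"
proof -
  have "v \<noteq> []" by (rule nonempty_if_perms[OF a(2) assms(2-4)])
  then have "inner_deriv q a z v - rot (\<lambda>b. q a b * row q s b) (inner_deriv q a z) v
      = twisted_deriv q a (\<lambda>w. z w - rot (row q s) z w) v"
    using a by (simp add: twisted_deriv_minus_rot)
  also have "\<dots> = twisted_deriv q a f v"
    by (rule twisted_deriv_cong_perms[OF f[symmetric] a])
  also have "\<dots> = 0" using assms(1) a by (simp add: annihilated_def)
  finally show ?thesis by simp
qed

text \<open>Injectivity of \<open>S\<close>: for a fixed last letter \<open>b\<close>, the inner derivatives are the derivatives of
  a function on the permutation words of \<open>s - {b}\<close>.\<close>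

lemma eq_0_if_inner_deriv_eq_0:
  assumes free: "\<And>a. a \<in> s \<Longrightarrow> const_free q (s - {a})"
    and 0: "\<And>a v. a \<in> s \<Longrightarrow> v \<in> perms (s - {a}) \<Longrightarrow> v \<noteq> [] \<Longrightarrow> inner_deriv q a z v = 0"
    and v: "v \<in> perms s" "v \<noteq> []"
  shows "z v = 0"
proof -
  obtain u b where ub: "v = u @ [b]" using v by (cases v rule: rev_cases) auto
  then have b: "b \<in> s" "u \<in> perms (s - {b})" using v by (auto simp: perms_snoc)
  show ?thesis
    unfolding ub
  proof (rule const_freeD[OF free[OF b(1)] _ b(2), where f = "\<lambda>w. z (w @ [b])"])
    fix a v assume "a \<in> s - {b}" "v \<in> perms (s - {b} - {a})"
    then have "a \<in> s" "v @ [b] \<in> perms (s - {a})"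
      using b by (auto simp: perms_iff)
    then show "twisted_deriv q a (\<lambda>w. z (w @ [b])) v = 0"
      using 0[of a "v @ [b]"] by simp
  qed
qed

text \<open>Here \<open>1 - R\<close> has the inverse \<open>orbit_sum / (1 - \<sigma>)\<close>, so every \<open>f\<close> is of the form \<open>z - R z\<close>, and
  \<open>S z\<close> vanishes because it is fixed by \<open>D\<close> while \<open>\<sigma> \<noteq> 1\<close>.\<close>

theorem const_free_if_sigma_neq_1:
  assumes fin: "finite s" and cd: "c \<in> s" "d \<in> s" "c \<noteq> d"
    and free: "\<And>a. a \<in> s \<Longrightarrow> const_free q (s - {a})"
    and sig: "prod (row q s) s \<noteq> 1"
  shows "const_free q s"
  unfolding const_free_def
proof (intro allI impI ballI)
  fix f v assume f: "annihilated q s f" and v: "v \<in> perms s"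
  define z where "z v = orbit_sum (row q s) f v / (1 - prod (row q s) s)" for v
  have z: "f v = z v - rot (row q s) z v" if "v \<in> perms s" for v
  proof -
    have "z v - rot (row q s) z v =
      (orbit_sum (row q s) f v - rot (row q s) (orbit_sum (row q s) f) v) / (1 - prod (row q s) s)"
      by (simp add: z_def rot_def diff_divide_distrib)
    then show ?thesis using sig that by (simp add: orbit_sum_minus_rot)
  qed
  have 0: "inner_deriv q a z v = 0" if a: "a \<in> s" "v \<in> perms (s - {a})" for a v
  proof -
    have "orbit_sum (\<lambda>b. q a b * row q s b) (\<lambda>_. 0) v
        = (1 - (\<Prod>b\<in>s - {a}. q a b * row q s b)) * inner_deriv q a z v"
      using inner_deriv_rot_invariant[OF f cd z] a by (intro orbit_sum_of_minus_rot) auto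
    then have "(1 - prod (row q s) s) * inner_deriv q a z v = 0"
      using fin a by (simp add: prod_inner_weights orbit_sum_def rot_pow_def)
    then show ?thesis using sig by simp
  qed
  have "z v = 0" if "v \<in> perms s" for v
    using that cd by (intro eq_0_if_inner_deriv_eq_0[OF free 0]) (auto simp: perms_iff)
  then show "f v = 0" using z v by (simp add: rot_def perms_rotate1)
qed

text \<open>With \<open>y = f - (z - R z)\<close>, which is supported on the words with first letter \<open>c\<close>, the
  factorisation gives \<open>T y = - (1 - D) S z\<close>, so the sum of \<open>T y\<close> over each \<open>D\<close>-orbit is zero.  For
  \<open>k \<noteq> c\<close> the value of \<open>T y\<close> at \<open>k # w\<close> vanishes unless \<open>w\<close> starts with \<open>c\<close>, because inserting \<open>k\<close>
  into \<open>w\<close> has to produce a word with first letter \<open>c\<close>.  The orbit sum thus reduces to one term, a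
  nonzero multiple of a derivative of \<open>y (c # _)\<close>.\<close>

lemma potential_of_annihilated:
  assumes fin: "finite s" and cd: "c \<in> s" "d \<in> s" "c \<noteq> d"
    and free: "const_free q (s - {c})"
    and sig: "prod (row q s) s = 1"
    and f: "annihilated q s f"
  defines "z \<equiv> potential c (row q s) f"
  shows "v \<in> perms s \<Longrightarrow> f v = z v - rot (row q s) z v"
    and "u @ [c] \<in> perms s \<Longrightarrow> z (u @ [c]) = 0"
proof -
  define y where "y v = f v - (z v - rot (row q s) z v)" for v
  have row0: "row q s a \<noteq> 0" if "a \<in> s" for a
    using prod_zero[OF fin, of "row q s"] sig that by auto
  have q0: "q a c \<noteq> 0" if "a \<in> s - {c}" for a
    using row0[of a] that fin cd by (auto simp: row_def prod_zero_iff)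
  have y0: "y (a # u) = 0" if "a \<noteq> c" "a # u \<in> perms s" for a u
  proof -
    have "c \<in> set u" using that cd by (auto simp: perms_iff)
    then show ?thesis
      using that by (simp add: y_def z_def potential_Cons_other)
  qed
  have y1: "y (c # u) = 0" if u: "u \<in> perms (s - {c})" for u
  proof (rule const_freeD[OF free _ u, where f = "\<lambda>w. y (c # w)"])
    fix k v assume kv: "k \<in> s - {c}" "v \<in> perms (s - {c} - {k})"
    \<comment> \<open>\<open>?h\<close> is \<open>T y\<close> on the words with first letter \<open>k\<close>.\<close>
    let ?h = "twisted_deriv q k y" and ?\<chi> = "\<lambda>b. q k b * row q s b"
    have cv: "c # v \<in> perms (s - {k})" using kv cd by (auto simp: perms_iff)
    have kcv: "k # c # v \<in> perms s" using kv cd by (auto simp: perms_iff)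
    have h: "?h w = (- inner_deriv q k z w) - rot ?\<chi> (\<lambda>w. - inner_deriv q k z w) w"
      if w: "w \<in> perms (s - {k})" for w
    proof -
      have "w \<noteq> []" by (rule nonempty_if_perms[OF w cd])
      have "?h w = twisted_deriv q k f w - twisted_deriv q k (\<lambda>v. z v - rot (row q s) z v) w"
        unfolding y_def by (rule twisted_deriv_diff)
      then show ?thesis
        using f kv w \<open>w \<noteq> []\<close>
        by (simp add: annihilated_def twisted_deriv_minus_rot) (simp add: rot_def)
    qed
    have "orbit_sum ?\<chi> ?h (c # v)
        = (1 - (\<Prod>b\<in>s - {k}. ?\<chi> b)) * (- inner_deriv q k z (c # v))"
      using h cv by (rule orbit_sum_of_minus_rot)
    then have "orbit_sum ?\<chi> ?h (c # v) = 0"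
      using fin kv sig by (simp add: prod_inner_weights)
    moreover have "orbit_sum ?\<chi> ?h (c # v) = ?h (c # v)"
    proof (rule orbit_sum_eq_self[OF cv])
      have "?h w = 0" if w: "w \<in> perms (s - {k})" and hd: "hd w \<noteq> c" for w
      proof -
        have "w \<noteq> []" by (rule nonempty_if_perms[OF w cd])
        have "?h w = twisted_deriv q k (\<lambda>v. if hd v = c then y v else 0) w"
        proof (rule twisted_deriv_cong_perms[where s = s])
          fix v assume "v \<in> perms s"
          then show "y v = (if hd v = c then y v else 0)"
            using y0[of "hd v" "tl v"] cd by (cases v) (auto simp: perms_iff)
        qed (use kv w in auto)
        also have "\<dots> = 0"
          using hd kv \<open>w \<noteq> []\<close> by (cases w) auto
        finally show ?thesis .
      qed
      then show "(\<forall>w\<in>perms (s - {k}). hd w \<noteq> hd (c # v) \<longrightarrow> ?h w = 0) \<or>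
        (\<forall>w\<in>perms (s - {k}). last w \<noteq> last (c # v) \<longrightarrow> ?h w = 0)"
        by auto
    qed simp
    ultimately have "?h (c # v) = 0" by simp
    then show "twisted_deriv q k (\<lambda>w. y (c # w)) v = 0"
      using y0[OF _ kcv] q0[of k] kv by simp
  qed
  show 1: "f v = z v - rot (row q s) z v" if "v \<in> perms s" for v
  proof -
    obtain a u where v: "v = a # u"
      using \<open>v \<in> perms s\<close> cd(1) by (cases v) (auto simp: perms_iff)
    have "y v = 0"
      using \<open>v \<in> perms s\<close> v y0[of a u] y1[of u] by (cases "a = c") (auto simp: perms_Cons)
    then show ?thesis by (simp add: y_def)
  qed
  \<comment> \<open>At \<open>c # u\<close> the potential equals \<open>f\<close>, so the equation just proved leaves no room for \<open>R z\<close>.\<close>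
  show "z (u @ [c]) = 0" if "u @ [c] \<in> perms s"
    using 1[of "c # u"] that row0[OF cd(1)]
    by (simp add: perms_Cons perms_snoc z_def potential_Cons_same)
qed

text \<open>The coordinates of a constant \<open>f\<close>: the value of \<open>w = S z\<close> at the word \<open>c # u @ [d]\<close>, where
  \<open>z\<close> is the potential with \<open>f = z - R z\<close>.\<close>

definition kernel_coord ::
    "('a \<Rightarrow> 'a \<Rightarrow> complex) \<Rightarrow> 'a set \<Rightarrow> 'a \<Rightarrow> 'a \<Rightarrow> 'a list \<Rightarrow> ('a list \<Rightarrow> complex) \<Rightarrow> complex" where
  "kernel_coord q s c d u f = inner_deriv q c (potential c (row q s) f) (u @ [d])"

lemma kernel_coord_cong:
  assumes f: "\<And>v. v \<in> perms s \<Longrightarrow> f v = g v"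
    and cd: "c \<in> s" "d \<in> s" "c \<noteq> d" and u: "u \<in> perms (s - {c} - {d})"
  shows "kernel_coord q s c d u f = kernel_coord q s c d u g"
proof -
  have "twisted_deriv q c (\<lambda>w. potential c (row q s) f (w @ [d])) u
      = twisted_deriv q c (\<lambda>w. potential c (row q s) g (w @ [d])) u"
  proof (rule twisted_deriv_cong_perms[where s = "s - {d}"])
    fix v assume "v \<in> perms (s - {d})"
    then have "rotate j (v @ [d]) \<in> perms s" for j using cd by (simp add: perms_rotate perms_snoc)
    then show "potential c (row q s) f (v @ [d]) = potential c (row q s) g (v @ [d])"
      using f by (simp add: potential_def rot_pow_def)
  qed (use cd u in \<open>simp_all add: perms_Diff_commute\<close>)
  then show ?thesis by (simp add: kernel_coord_def)
qed

text \<open>The \<open>D\<close>-invariant function \<open>S z\<close> is zero on each orbit, since each orbit contains a word at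
  which it vanishes: one with last letter \<open>c\<close>, where \<open>z\<close> is zero, if the first letter is not \<open>c\<close>,
  and one with last letter \<open>d\<close> otherwise.  Injectivity of \<open>S\<close> then gives \<open>z = 0\<close>.\<close>

theorem annihilated_eq_0_if_coords_eq_0:
  assumes fin: "finite s" and cd: "c \<in> s" "d \<in> s" "c \<noteq> d"
    and free: "\<And>a. a \<in> s \<Longrightarrow> const_free q (s - {a})"
    and sig: "prod (row q s) s = 1"
    and f: "annihilated q s f"
    and coords: "\<And>u. u \<in> perms (s - {c} - {d}) \<Longrightarrow> kernel_coord q s c d u f = 0"
    and v: "v \<in> perms s"
  shows "f v = 0"
proof -
  define z where "z = potential c (row q s) f"
  note z = potential_of_annihilated[OF fin cd free[OF cd(1)] sig f, folded z_def]
  have 0: "inner_deriv q a z v = 0" if a: "a \<in> s" "v \<in> perms (s - {a})" for a v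
  proof (cases "a = c")
    case True
    show ?thesis
    proof (rule rot_invariant_eq_0[where b = d])
      show "inner_deriv q a z w = rot (\<lambda>b. q a b * row q s b) (inner_deriv q a z) w"
        if "w \<in> perms (s - {a})" for w
        using that by (intro inner_deriv_rot_invariant[OF f cd z(1)] a)
      fix u assume "u @ [d] \<in> perms (s - {a})"
      then have "u \<in> perms (s - {c} - {d})" using True by (simp add: perms_snoc)
      then show "inner_deriv q a z (u @ [d]) = 0"
        using coords True unfolding kernel_coord_def z_def by blast
    qed (use a cd True in auto)
  next
    case False
    show ?thesis
    proof (rule rot_invariant_eq_0[where b = c])
      show "inner_deriv q a z w = rot (\<lambda>b. q a b * row q s b) (inner_deriv q a z) w"
        if "w \<in> perms (s - {a})" for w
        using that by (intro inner_deriv_rot_invariant[OF f cd z(1)] a)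
      fix u assume u: "u @ [c] \<in> perms (s - {a})"
      have "twisted_deriv q a (\<lambda>w. z (w @ [c])) u = twisted_deriv q a (\<lambda>_. 0) u"
      proof (rule twisted_deriv_cong_perms[where s = "s - {c}"])
        show "z (v @ [c]) = 0" if "v \<in> perms (s - {c})" for v
          using that cd z(2) by (simp add: perms_snoc)
      qed (use u a False in \<open>auto simp: perms_snoc perms_Diff_commute\<close>)
      then show "inner_deriv q a z (u @ [c]) = 0" by simp
    qed (use a cd False in auto)
  qed
  have "z v = 0" if "v \<in> perms s" for v
    using that cd by (intro eq_0_if_inner_deriv_eq_0[OF free 0]) (auto simp: perms_iff)
  then show ?thesis using z(1) v by (simp add: rot_def perms_rotate1)
qed

text \<open>The construction of \<open>f\<close> reverses the passage from \<open>f\<close> to its coordinates: \<open>w\<close> is the invariant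
  function on the words with first letter \<open>c\<close> with the prescribed coordinates, \<open>z\<close> solves \<open>S z = w\<close>
  separately for every last letter \<open>b\<close>, with \<open>z = 0\<close> for \<open>b = c\<close>, and \<open>f = z - R z\<close>.\<close>

theorem annihilated_dual_basis:
  assumes fin: "finite s" and cd: "c \<in> s" "d \<in> s" "c \<noteq> d"
    and free: "const_free q (s - {c})"
    and solvable: "\<And>a w. a \<in> s \<Longrightarrow> \<exists>g. \<forall>b\<in>s - {a}. \<forall>v\<in>perms (s - {a} - {b}).
      twisted_deriv q b g v = w b v"
    and sig: "prod (row q s) s = 1"
    and u0: "u0 \<in> perms (s - {c} - {d})"
  shows "\<exists>f. annihilated q s f \<and>
    (\<forall>u\<in>perms (s - {c} - {d}). kernel_coord q s c d u f = (if u = u0 then 1 else 0))"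
proof -
  let ?\<chi> = "\<lambda>a b. q a b * row q s b"
  define e :: "'a list \<Rightarrow> complex" where "e v = (if v = u0 @ [d] then 1 else 0)" for v
  define w where "w = orbit_sum (?\<chi> c) e"
  have w_inv: "w v = rot (?\<chi> c) w v" if "v \<in> perms (s - {c})" for v
    using orbit_sum_minus_rot[OF that, of "?\<chi> c" e] fin cd sig
    by (simp add: prod_inner_weights w_def)
  have w_val: "w (u @ [d]) = (if u = u0 then 1 else 0)" if "u \<in> perms (s - {c} - {d})" for u
  proof -
    have "w (u @ [d]) = e (u @ [d])"
      unfolding w_def
    proof (rule orbit_sum_eq_self[where t = "s - {c}"])
      show "u @ [d] \<in> perms (s - {c})" using that cd by (simp add: perms_snoc)
    qed (auto simp: e_def)
    then show ?thesis by (simp add: e_def)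
  qed
  define t where "t b a v = (if a = c then w (v @ [b]) else 0)" for a b v
  have "\<exists>g. \<forall>b\<in>s. \<forall>a\<in>s - {b}. \<forall>v\<in>perms (s - {b} - {a}). twisted_deriv q a (g b) v = t b a v"
    using solvable by (intro bchoice ballI) blast
  then obtain g where g: "\<And>a b v. b \<in> s \<Longrightarrow> a \<in> s - {b} \<Longrightarrow> v \<in> perms (s - {b} - {a}) \<Longrightarrow>
      twisted_deriv q a (g b) v = t b a v"
    by blast
  define z where "z v = (if last v = c then 0 else g (last v) (butlast v))" for v
  define f where "f v = z v - rot (row q s) z v" for v
  have inner: "inner_deriv q a z v = (if a = c then w v else 0)"
    if a: "a \<in> s" "v \<in> perms (s - {a})" for a v
  proof -
    have "v \<noteq> []" by (rule nonempty_if_perms[OF a(2) cd])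
    then obtain v' b where vb: "v = v' @ [b]" by (cases v rule: rev_cases) auto
    have b: "b \<in> s" "a \<in> s - {b}" "v' \<in> perms (s - {b} - {a})"
      using a vb perms_Diff_commute[of s a b] by (auto simp: perms_snoc)
    then show ?thesis
      using g[OF b] by (cases "b = c") (auto simp: vb z_def t_def)
  qed
  have ann: "annihilated q s f"
    unfolding annihilated_def
  proof (intro ballI)
    fix a v assume a: "a \<in> s" "v \<in> perms (s - {a})"
    have "v \<noteq> []" by (rule nonempty_if_perms[OF a(2) cd])
    then have "twisted_deriv q a f v
        = inner_deriv q a z v - rot (?\<chi> a) (inner_deriv q a z) v"
      unfolding f_def using a by (simp add: twisted_deriv_minus_rot)
    also have "rot (?\<chi> a) (inner_deriv q a z) v = rot (?\<chi> a) (\<lambda>v. if a = c then w v else 0) v"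
      using a by (simp add: rot_def inner perms_rotate1)
    finally show "twisted_deriv q a f v = 0"
      using a w_inv[of v] by (cases "a = c") (simp_all add: inner rot_def)
  qed
  \<comment> \<open>Both functions solve \<open>f = z - R z\<close> and vanish on the words with last letter \<open>c\<close>, and their
    difference is rotation invariant.\<close>
  have pot: "potential c (row q s) f v = z v" if v: "v \<in> perms s" for v
  proof -
    note p = potential_of_annihilated[OF fin cd free sig ann]
    have "potential c (row q s) f v - z v = 0"
    proof (rule rot_invariant_eq_0[where b = c and g = "\<lambda>v. potential c (row q s) f v - z v"])
      fix v assume "v \<in> perms s"
      then show "potential c (row q s) f v - z v
          = rot (row q s) (\<lambda>v. potential c (row q s) f v - z v) v"
        using p(1)[of v] by (simp add: f_def rot_def algebra_simps)
    next
      fix u assume "u @ [c] \<in> perms s"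
      then show "potential c (row q s) f (u @ [c]) - z (u @ [c]) = 0"
        using p(2) by (simp add: z_def)
    qed (use cd v in auto)
    then show ?thesis by simp
  qed
  have "kernel_coord q s c d u f = (if u = u0 then 1 else 0)" if u: "u \<in> perms (s - {c} - {d})" for u
  proof -
    have ud: "u @ [d] \<in> perms (s - {c})" using u cd by (simp add: perms_snoc)
    have "twisted_deriv q c (\<lambda>x. potential c (row q s) f (x @ [d])) u
        = twisted_deriv q c (\<lambda>x. z (x @ [d])) u"
    proof (rule twisted_deriv_cong_perms[where s = "s - {d}"])
      show "potential c (row q s) f (x @ [d]) = z (x @ [d])" if "x \<in> perms (s - {d})" for x
        using that cd by (intro pot) (simp add: perms_snoc)
    qed (use u cd in \<open>simp_all add: perms_Diff_commute\<close>)
    then have "kernel_coord q s c d u f = inner_deriv q c z (u @ [d])"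
      by (simp add: kernel_coord_def)
    then show ?thesis using inner[OF cd(1) ud] w_val[OF u] by simp
  qed
  with ann show ?thesis by blast
qed

section \<open>Linear algebra\<close>

lemma (in vector_space) dim_eq_card_if_dual:
  assumes I: "finite I" and K: "subspace K"
    and \<kappa>: "\<And>i. i \<in> I \<Longrightarrow> Vector_Spaces.linear scale (*) (\<kappa> i)"
    and sep: "\<And>x. x \<in> K \<Longrightarrow> (\<And>i. i \<in> I \<Longrightarrow> \<kappa> i x = 0) \<Longrightarrow> x = 0"
    and dual: "\<And>j. j \<in> I \<Longrightarrow> \<exists>x\<in>K. \<forall>i\<in>I. \<kappa> i x = (if i = j then 1 else 0)"
  shows "dim K = card I"
proof -
  obtain b where b: "\<And>j. j \<in> I \<Longrightarrow> b j \<in> K"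
    and \<kappa>b: "\<And>i j. i \<in> I \<Longrightarrow> j \<in> I \<Longrightarrow> \<kappa> i (b j) = (if i = j then 1 else 0)"
    using dual by metis
  have inj: "inj_on b I"
    by (rule inj_onI) (metis \<kappa>b zero_neq_one)
  have coord: "\<kappa> i (\<Sum>j\<in>I. scale (c j) (b j)) = c i" if i: "i \<in> I" for c i
  proof -
    have "\<kappa> i (\<Sum>j\<in>I. scale (c j) (b j)) = (\<Sum>j\<in>I. c j * \<kappa> i (b j))"
      using \<kappa>[OF i] by (simp add: linear_iff_module_hom module_hom.sum module_hom.scale)
    also have "\<dots> = (\<Sum>j\<in>I. if i = j then c j else 0)"
      using i by (intro sum.cong) (simp_all add: \<kappa>b)
    also have "\<dots> = c i" using I i by simp
    finally show ?thesis .
  qed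
  have "independent (b ` I)"
  proof
    assume "dependent (b ` I)"
    then obtain u j where j: "j \<in> I" "u (b j) \<noteq> 0" and "(\<Sum>v\<in>b ` I. scale (u v) v) = 0"
      using I by (subst (asm) dependent_finite) auto
    then have "(\<Sum>j\<in>I. scale (u (b j)) (b j)) = 0"
      by (simp add: sum.reindex[OF inj])
    moreover have "\<kappa> j 0 = 0"
      using \<kappa>[OF j(1)] by (simp add: linear_iff_module_hom module_hom.zero)
    ultimately show False using coord[OF j(1), of "\<lambda>j. u (b j)"] j(2) by simp
  qed
  moreover have "K \<subseteq> span (b ` I)"
  proof
    fix x assume x: "x \<in> K"
    let ?y = "\<Sum>j\<in>I. scale (\<kappa> j x) (b j)"
    have "?y \<in> K" using b by (intro subspace_sum[OF K] subspace_scale[OF K])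
    moreover have "\<kappa> i (x - ?y) = 0" if "i \<in> I" for i
      using \<kappa>[OF that] coord[OF that, of "\<lambda>j. \<kappa> j x"]
      by (simp add: linear_iff_module_hom module_hom.diff)
    ultimately have "x - ?y = 0" using x by (intro sep subspace_diff[OF K])
    moreover have "?y \<in> span (b ` I)" by (intro span_sum span_scale span_base) auto
    ultimately show "x \<in> span (b ` I)" by simp
  qed
  ultimately show ?thesis
    using b card_image[OF inj] by (intro dim_unique[of "b ` I"]) auto
qed

text \<open>The ambient space may have infinite dimension, so the count is made inside the span: the image
  of a basis is independent and has the size of a basis.\<close>

lemma (in vector_space) linear_inj_on_finite_span_imp_surj:
  assumes lin: "Vector_Spaces.linear scale scale f" and B: "finite B"
    and into: "\<And>x. x \<in> span B \<Longrightarrow> f x \<in> span B"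
    and inj: "\<And>x. x \<in> span B \<Longrightarrow> f x = 0 \<Longrightarrow> x = 0"
    and y: "y \<in> span B"
  shows "\<exists>x\<in>span B. f x = y"
proof -
  interpret p: vector_space_pair scale scale ..
  obtain B' where B': "B' \<subseteq> B" "independent B'" "B \<subseteq> span B'"
    using maximal_independent_subset by blast
  have fin: "finite B'" using B B'(1) by (rule rev_finite_subset)
  have sp: "span B' = span B" 
    using span_mono[OF B'(1)] span_minimal[OF B'(3) subspace_span] by (rule subset_antisym)
  have f_inj: "inj_on f (span B')"
  proof (rule inj_onI)
    fix a b assume ab: "a \<in> span B'" "b \<in> span B'" "f a = f b"
    have "a - b = 0"
    proof (rule inj)
      show "a - b \<in> span B" using ab sp by (simp add: span_diff)
      show "f (a - b) = 0" using ab(3) by (simp add: p.linear_diff[OF lin])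
    qed
    then show "a = b" by simp
  qed
  have ind: "independent (f ` B')"
    by (rule p.linear_independent_injective_image[OF lin B'(2) f_inj])
  have card: "card (f ` B') = card B'"
    by (rule card_image) (rule inj_on_subset[OF f_inj span_superset])
  have "y \<in> span (f ` B')"
  proof (rule ccontr)
    assume n: "y \<notin> span (f ` B')"
    have "insert y (f ` B') \<subseteq> span B'"
      using y into span_superset[of B'] sp by auto
    then have "card (insert y (f ` B')) \<le> card B'"
      using independent_span_bound[OF fin independent_insertI[OF n ind]] by simp
    moreover have "y \<notin> f ` B'" using n span_superset[of "f ` B'"] by blast
    ultimately show False using fin card by simp
  qed
  then have "y \<in> f ` span B'" using p.linear_span_image[OF lin] by simp
  then show ?thesis using sp by auto
qed


section \<open>Multilinear elements of the free algebra\<close>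

definition coef :: "falg \<Rightarrow> nat list \<Rightarrow> complex" where
  "coef x w = Poly_Mapping.lookup x (FWord w)"

lemma coef_add: "coef (x + y) w = coef x w + coef y w"
  by (simp add: coef_def lookup_add)

lemma coef_scale: "coef (scale c x) w = c * coef x w"
  by (simp add: coef_def)

lemma coef_zero [simp]: "coef 0 = (\<lambda>_. 0)"
  by (simp add: coef_def fun_eq_iff)

lemma coef_sum: "coef (sum f A) w = (\<Sum>i\<in>A. coef (f i) w)"
  by (induction A rule: infinite_finite_induct) (simp_all add: coef_add)

lemma coef_single: "coef (Poly_Mapping.single (FWord v) c) w = (if w = v then c else 0)"
  by (auto simp: coef_def lookup_single when_def)

lemma falg_eqI:
  assumes "\<And>w. coef x w = coef y w"
  shows "x = y"
proof (rule poly_mapping_eqI)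
  fix w show "Poly_Mapping.lookup x w = Poly_Mapping.lookup y w"
    using assms[of "letters w"] by (simp add: coef_def)
qed

lemma coef_xi_mult_Nil: "coef (xi j * x) [] = 0"
proof (induction x rule: falg_induct)
  case (single w c)
  then show ?case by (cases w) (simp add: xi_def mult_single plus_fword_def coef_single)
next
  case (sum x y)
  then show ?case by (simp add: distrib_left coef_add)
qed

lemma coef_xi_mult_Cons: "coef (xi j * x) (b # u) = (if b = j then coef x u else 0)"
proof (induction x rule: falg_induct)
  case (single w c)
  then show ?case by (cases w) (simp add: xi_def mult_single plus_fword_def coef_single)
next
  case (sum x y)
  then show ?case by (simp add: distrib_left coef_add)
qed

lemma prod_list_xi: "prod_list (map xi js) = Poly_Mapping.single (FWord js) 1"
  by (induction js) (simp_all add: xi_def mult_single plus_fword_def flip: zero_fword_def)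

lemma coef_pd_word:
  "coef (pd_word q i js) u = twisted_deriv q i (\<lambda>w. if w = js then 1 else 0) u"
proof (induction js arbitrary: u)
  case Nil
  then show ?case by (cases u) simp_all
next
  case (Cons j js)
  then show ?case
    by (cases u) (auto simp: coef_add coef_scale coef_single coef_xi_mult_Nil coef_xi_mult_Cons)
qed

lemma coef_pd: "coef (pd q i x) u = twisted_deriv q i (coef x) u"
proof (induction x rule: falg_induct)
  case (single w c)
  have "coef (Poly_Mapping.single w c) = (\<lambda>v. c * (if v = letters w then 1 else 0))"
    by (cases w) (auto simp: coef_single)
  then have "twisted_deriv q i (coef (Poly_Mapping.single w c)) u
      = c * twisted_deriv q i (\<lambda>v. if v = letters w then 1 else 0) u"
    by (simp only: twisted_deriv_cmult)
  then show ?case by (simp add: pd_single coef_scale coef_pd_word)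
next
  case (sum x y)
  have "coef (x + y) = (\<lambda>w. coef x w + coef y w)" by (simp add: fun_eq_iff coef_add)
  then show ?case using sum by (simp add: pd_add coef_add twisted_deriv_add)
qed

definition perm_poly :: "nat set \<Rightarrow> (nat list \<Rightarrow> complex) \<Rightarrow> falg" where
  "perm_poly s f = (\<Sum>w\<in>perms s. scale (f w) (prod_list (map xi w)))"

lemma coef_perm_poly: "coef (perm_poly s f) w = (if w \<in> perms s then f w else 0)"
proof -
  have "coef (perm_poly s f) w = (\<Sum>v\<in>perms s. if w = v then f v else 0)"
    unfolding perm_poly_def coef_sum
    by (intro sum.cong) (simp_all add: coef_scale prod_list_xi coef_single)
  then show ?thesis by simp
qed

lemma multilinear_iff: "x \<in> multilinear s \<longleftrightarrow> (\<forall>w. w \<notin> perms s \<longrightarrow> coef x w = 0)"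
proof
  show "\<forall>w. w \<notin> perms s \<longrightarrow> coef x w = 0" if "x \<in> multilinear s"
    using that unfolding multilinear_def
  proof (induction rule: falg.span_induct_alt)
    case (step c v y)
    then show ?case by (auto simp: coef_add coef_scale prod_list_xi coef_single split: if_splits)
  qed simp
next
  assume "\<forall>w. w \<notin> perms s \<longrightarrow> coef x w = 0"
  then have "x = perm_poly s (coef x)"
    by (intro falg_eqI) (simp add: coef_perm_poly)
  also have "\<dots> \<in> multilinear s"
    unfolding perm_poly_def multilinear_def
    by (intro falg.span_sum falg.span_scale falg.span_base) auto
  finally show "x \<in> multilinear s" .
qed

lemma multilinear_zeroI:
  assumes "x \<in> multilinear s" "\<And>v. v \<in> perms s \<Longrightarrow> coef x v = 0"
  shows "x = 0"
  using assms by (intro falg_eqI) (auto simp: multilinear_iff)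

lemma twisted_deriv_eq_0_outside:
  assumes "\<And>v. v \<notin> perms s \<Longrightarrow> f v = 0" "\<not> (a \<in> s \<and> u \<in> perms (s - {a}))"
  shows "twisted_deriv q a f u = 0"
proof -
  have "twisted_deriv q a f u = twisted_deriv q a (\<lambda>_. 0) u"
  proof (rule twisted_deriv_cong)
    fix v assume "mset v = add_mset a (mset u)"
    then have "v \<notin> perms s" using assms(2) by (simp add: perms_insertion)
    then show "f v = 0" by (rule assms(1))
  qed
  then show ?thesis by simp
qed

text \<open>The derivatives \<open>\<partial>\<^sub>i x\<close> of an element of \<open>\<B>\<^sub>(\<^sub>s\<^sub>)\<close> vanish for \<open>i\<close> outside \<open>s\<close>, and for \<open>i\<close> in \<open>s\<close>
  they lie in \<open>\<B>\<^sub>(\<^sub>s\<^sub>-\<^sub>i\<^sub>)\<close>, so it suffices to test them on permutation words.\<close>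

lemma constants_in_multilinear_iff:
  assumes "s \<noteq> {}" "s \<subseteq> {1..N}"
  shows "x \<in> constants_in N q (multilinear s) \<longleftrightarrow> x \<in> multilinear s \<and> annihilated q s (coef x)"
proof (cases "x = 0")
  case True
  then show ?thesis by (simp add: constants_in_def multilinear_iff annihilated_def)
next
  case False
  have "x \<in> free_algebra N \<and> coef x [] = 0" if "x \<in> multilinear s"
  proof
    show "x \<in> free_algebra N"
      unfolding free_algebra_def
    proof (intro CollectI ballI)
      fix w assume "w \<in> Poly_Mapping.keys x"
      then have "coef x (letters w) \<noteq> 0" by (simp add: coef_def in_keys_iff)
      then have "letters w \<in> perms s" using that by (auto simp: multilinear_iff)
      then show "set (letters w) \<subseteq> {1..N}" using assms(2) by (simp add: perms_iff)
    qed
    show "coef x [] = 0" using that assms(1) by (simp add: multilinear_iff perms_iff)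
  qed
  moreover have "(\<forall>i\<in>{1..N}. pd q i x = 0) \<longleftrightarrow> annihilated q s (coef x)" if "x \<in> multilinear s"
  proof
    assume "\<forall>i\<in>{1..N}. pd q i x = 0"
    then have "twisted_deriv q a (coef x) v = 0" if "a \<in> s" for a v
      using that assms(2) coef_pd[of q a x v] by auto
    then show "annihilated q s (coef x)" by (simp add: annihilated_def)
  next
    assume ann: "annihilated q s (coef x)"
    have "twisted_deriv q i (coef x) u = 0" for i u
    proof (cases "i \<in> s \<and> u \<in> perms (s - {i})")
      case True
      then show ?thesis using ann by (simp add: annihilated_def)
    next
      case False
      then show ?thesis
        using that by (intro twisted_deriv_eq_0_outside[of s]) (auto simp: multilinear_iff)
    qed
    then show "\<forall>i\<in>{1..N}. pd q i x = 0"
      by (auto intro: falg_eqI simp: coef_pd)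
  qed
  ultimately show ?thesis
    using False by (auto simp: constants_in_def is_constant_def coef_def)
qed

lemma annihilated_cong:
  assumes "\<And>v. v \<in> perms s \<Longrightarrow> f v = g v"
  shows "annihilated q s f \<longleftrightarrow> annihilated q s g"
proof -
  have "twisted_deriv q a f v = twisted_deriv q a g v" if "a \<in> s" "v \<in> perms (s - {a})" for a v
    by (rule twisted_deriv_cong_perms[OF assms that])
  then show ?thesis by (simp add: annihilated_def)
qed

lemma const_free_if_no_constant:
  assumes "s \<noteq> {}" "s \<subseteq> {1..N}" "\<not> (\<exists>C\<in>multilinear s. is_constant N q C)"
  shows "const_free q s"
  unfolding const_free_def
proof (intro allI impI ballI)
  fix f v assume f: "annihilated q s f" and v: "v \<in> perms s"
  have "annihilated q s (coef (perm_poly s f))"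
    using f by (subst annihilated_cong[of s _ f]) (simp_all add: coef_perm_poly)
  then have "perm_poly s f \<in> constants_in N q (multilinear s)"
    using assms by (simp add: constants_in_multilinear_iff multilinear_iff coef_perm_poly)
  then have "perm_poly s f = 0" using assms(3) by (auto simp: constants_in_def)
  then show "f v = 0" using v coef_perm_poly[of s f v] by simp
qed

text \<open>The operator \<open>T\<close> collects all derivatives in one endomorphism of the finite-dimensional space
  \<open>\<B>\<^sub>(\<^sub>t\<^sub>)\<close>, and the absence of constants makes it injective, hence surjective.\<close>

lemma twisted_deriv_solvable:
  fixes q :: "nat \<Rightarrow> nat \<Rightarrow> complex"
  assumes fin: "finite t" and free: "const_free q t"
  shows "\<exists>g. \<forall>b\<in>t. \<forall>v\<in>perms (t - {b}). twisted_deriv q b g v = w b v"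
proof -
  define B where "B = {prod_list (map xi js) | js. js \<in> perms t}"
  have B: "finite B" "falg.span B = multilinear t"
    by (auto simp: B_def multilinear_def)
  define \<tau> where "\<tau> x = (\<Sum>a\<in>t. xi a * pd q a x)" for x
  have coef_\<tau>: "coef (\<tau> x) (a # v) = twisted_deriv q a (coef x) v" if "a \<in> t" for x a v
  proof -
    have "coef (\<tau> x) (a # v) = (\<Sum>b\<in>t. if a = b then coef (pd q b x) v else 0)"
      by (simp add: \<tau>_def coef_sum coef_xi_mult_Cons)
    then show ?thesis using fin that by (simp add: coef_pd)
  qed
  have lin: "Vector_Spaces.linear scale scale \<tau>"
    by unfold_locales
      (simp_all add: \<tau>_def pd_add pd_scale distrib_left sum.distrib scale_mult_right
        falg.scale_sum_right)
  have into: "\<tau> x \<in> multilinear t" if x: "x \<in> multilinear t" for x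
    unfolding multilinear_iff
  proof (intro allI impI)
    fix w assume w: "w \<notin> perms t"
    show "coef (\<tau> x) w = 0"
    proof (cases w)
      case Nil
      then show ?thesis by (simp add: \<tau>_def coef_sum coef_xi_mult_Nil)
    next
      case (Cons a v)
      show ?thesis
      proof (cases "a \<in> t")
        case True
        have "twisted_deriv q a (coef x) v = 0"
          using x w Cons by (intro twisted_deriv_eq_0_outside[of t]) (auto simp: multilinear_iff perms_Cons)
        then show ?thesis using True Cons by (simp add: coef_\<tau>)
      next
        case False
        then show ?thesis using Cons by (auto simp: \<tau>_def coef_sum coef_xi_mult_Cons intro!: sum.neutral)
      qed
    qed
  qed
  have inj: "x = 0" if x: "x \<in> multilinear t" "\<tau> x = 0" for x
  proof (rule multilinear_zeroI[OF x(1)])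
    fix v assume "v \<in> perms t"
    then show "coef x v = 0"
      by (rule const_freeD[OF free, rotated]) (use coef_\<tau>[of _ x] x(2) in simp)
  qed
  define f where "f u = w (hd u) (tl u)" for u
  have "perm_poly t f \<in> multilinear t" by (simp add: multilinear_iff coef_perm_poly)
  then obtain x where "\<tau> x = perm_poly t f"
    using falg.linear_inj_on_finite_span_imp_surj[OF lin B(1)] into inj unfolding B(2) by blast
  then have "twisted_deriv q b (coef x) v = w b v" if "b \<in> t" "v \<in> perms (t - {b})" for b v
    using that coef_\<tau>[of b x v] by (simp add: coef_perm_poly perms_Cons f_def)
  then show ?thesis by blast
qed

lemma linear_kernel_coord:
  "Vector_Spaces.linear scale (*) (\<lambda>x. kernel_coord q s c d u (coef x))"
proof -
  have pot_add: "potential c \<chi> (coef (x + y)) v = potential c \<chi> (coef x) v + potential c \<chi> (coef y) v"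
    for c \<chi> x y v
    by (simp add: potential_def rot_pow_def coef_add sum.distrib distrib_left)
  have pot_scale: "potential c \<chi> (coef (scale r x)) v = r * potential c \<chi> (coef x) v"
    for c \<chi> r x v
    by (simp add: potential_def rot_pow_def coef_scale sum_distrib_left mult.left_commute)
  show ?thesis
    by unfold_locales
      (simp_all add: kernel_coord_def pot_add pot_scale twisted_deriv_add twisted_deriv_cmult
        algebra_simps)
qed

theorem dim_constants_in_multilinear:
  assumes fin: "finite s" and sN: "s \<subseteq> {1..N}" and cd: "c \<in> s" "d \<in> s" "c \<noteq> d"
    and free: "\<And>a. a \<in> s \<Longrightarrow> const_free q (s - {a})"
  shows "falg.dim (constants_in N q (multilinear s)) =
    (if sigma q s = 1 then fact (card s - 2) else 0)"
proof -
  let ?K = "constants_in N q (multilinear s)"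
  have "s \<noteq> {}" using cd(1) by blast
  then have K: "x \<in> ?K \<longleftrightarrow> x \<in> multilinear s \<and> annihilated q s (coef x)" for x
    using sN by (rule constants_in_multilinear_iff)
  have sig: "sigma q s = prod (row q s) s" using fin by (rule sigma_eq_prod_row)
  show ?thesis
  proof (cases "sigma q s = 1")
    case False
    then have s: "const_free q s"
      using sig by (intro const_free_if_sigma_neq_1[OF fin cd free]) simp_all
    have "x = 0" if "x \<in> ?K" for x
    proof (rule multilinear_zeroI)
      show "x \<in> multilinear s" using that by (simp add: K)
      show "coef x v = 0" if "v \<in> perms s" for v
        using s that \<open>x \<in> ?K\<close> by (simp add: K const_free_def)
    qed
    then have "?K = {0}" by (auto simp: constants_in_def)
    then show ?thesis using False falg.dim_unique[of "{}" ?K 0] falg.independent_empty by simp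
  next
    case True
    then have sig1: "prod (row q s) s = 1" using sig by simp
    let ?I = "perms (s - {c} - {d})"
    have "falg.dim ?K = card ?I"
    proof (rule falg.dim_eq_card_if_dual)
      show "finite ?I" by simp
      show "falg.subspace ?K"
        by (rule subspace_constants_in) (simp add: multilinear_def)
      show "Vector_Spaces.linear scale (*) (\<lambda>x. kernel_coord q s c d u (coef x))" for u
        by (rule linear_kernel_coord)
      show "x = 0"
        if x: "x \<in> ?K" and coords: "\<And>u. u \<in> ?I \<Longrightarrow> kernel_coord q s c d u (coef x) = 0" for x
      proof (rule multilinear_zeroI)
        show "x \<in> multilinear s" using x by (simp add: K)
        have ann: "annihilated q s (coef x)" using x by (simp add: K)
        show "coef x v = 0" if "v \<in> perms s" for v
          by (rule annihilated_eq_0_if_coords_eq_0[OF fin cd free sig1 ann coords that])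
      qed
      fix u0 assume u0: "u0 \<in> ?I"
      have "\<exists>g. \<forall>b\<in>s - {a}. \<forall>v\<in>perms (s - {a} - {b}). twisted_deriv q b g v = w b v"
        if "a \<in> s" for a w
        using fin free[OF that] by (intro twisted_deriv_solvable) simp_all
      then obtain f where f: "annihilated q s f"
        "\<forall>u\<in>?I. kernel_coord q s c d u f = (if u = u0 then 1 else 0)"
        using annihilated_dual_basis[OF fin cd free[OF cd(1)] _ sig1 u0] by blast
      show "\<exists>x\<in>?K. \<forall>u\<in>?I. kernel_coord q s c d u (coef x) = (if u = u0 then 1 else 0)"
      proof (intro bexI[of _ "perm_poly s f"] ballI)
        have "annihilated q s (coef (perm_poly s f))"
          using f(1) by (subst annihilated_cong[of s _ f]) (simp_all add: coef_perm_poly)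
        then show "perm_poly s f \<in> ?K" by (simp add: K multilinear_iff coef_perm_poly)
        fix u assume u: "u \<in> ?I"
        have "kernel_coord q s c d u (coef (perm_poly s f)) = kernel_coord q s c d u f"
          by (rule kernel_coord_cong[OF _ cd u]) (simp add: coef_perm_poly)
        then show "kernel_coord q s c d u (coef (perm_poly s f)) = (if u = u0 then 1 else 0)"
          using f(2) u by simp
      qed
    qed
    also have "card ?I = fact (card s - 2)"
      using fin cd by (simp add: numeral_2_eq_2)
    finally show ?thesis using True by simp
  qed
qed

theorem theorem4p1p2:
  fixes N m :: nat and q :: "nat \<Rightarrow> nat \<Rightarrow> complex"
  assumes "2 \<le> m" and "m \<le> N"
    and "\<And>s. s \<noteq> {} \<Longrightarrow> s \<subset> {1..m} \<Longrightarrow> \<not> (\<exists>C \<in> multilinear s. is_constant N q C)"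
  shows "falg.dim (constants_in N q (multilinear {1..m})) =
           (if sigma q {1..m} = 1 then fact (m - 2) else 0)"
proof -
  have cd: "1 \<in> {1..m}" "2 \<in> {1..m}" "(1::nat) \<noteq> 2" using assms(1) by auto
  have free: "const_free q ({1..m} - {a})" if "a \<in> {1..m}" for a
  proof (rule const_free_if_no_constant)
    show ne: "{1..m} - {a} \<noteq> {}" using cd by blast
    show "\<not> (\<exists>C\<in>multilinear ({1..m} - {a}). is_constant N q C)"
      by (rule assms(3)[OF ne]) (use that in blast)
    show "{1..m} - {a} \<subseteq> {1..N}" using assms(2) by auto
  qed
  have "{1..m} \<subseteq> {1..N}" using assms(2) by auto
  from dim_constants_in_multilinear[OF _ this cd free] show ?thesis by simp
qed

end
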